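(* The Hindman ideal $\mathcal{H}=\{A\subseteq\omega : A \text{ is not an IP-set}\}$ is a $\mathbf{\Pi}_1^1$-complete subset of $\mathcal{P}(\omega)$.
   Context: $\omega=\{0,1,2,\dots\}$. $\mathcal{P}(\omega)$ is identified with the Cantor space $2^\omega$ via characteristic functions, and so is a Polish space. For an infinite $B\subseteq\omega$ put $\mathrm{FS}(B)=\{\sum_{n\in F}n : F\subseteq B \text{ nonempty and finite}\}$. A set $A\subseteq\omega$ is an IP-set if there is an infinite $B\subseteq A$ with $\mathrm{FS}(B)\subseteq A$. Completeness: for Polish spaces $\mathcal{X},\mathcal{Y}$ and $A\subseteq\mathcal{X}$, $B\subseteq\mathcal{Y}$, $B$ is Borel reducible to $A$ if there is a Borel function $f:\mathcal{Y}\to\mathcal{X}$ with $f^{-1}[A]=B$. $A\subseteq\mathcal{X}$ is $\mathbf{\Sigma}_1^1$-complete if $A$ is analytic and for every Polish space $\mathcal{Y}$ every analytic $B\subseteq\mathcal{Y}$ is Borel reducible to $A$. $A\subseteq\mathcal{X}$ is $\mathbf{\Pi}_1^1$-complete if $\mathcal{X}\setminus A$ is $\mathbf{\Sigma}_1^1$-complete. *)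

theory Defs
  imports "HOL-Analysis.Analysis"
begin

definition FS :: "nat set \<Rightarrow> nat set" where
  "FS B = {\<Sum>F | F. F \<subseteq> B \<and> F \<noteq> {} \<and> finite F}"

definition IP_set :: "nat set \<Rightarrow> bool" where
  "IP_set A \<longleftrightarrow> (\<exists>B. infinite B \<and> B \<subseteq> A \<and> FS B \<subseteq> A)"

definition Hindman_ideal :: "nat set set" where
  "Hindman_ideal = {A. \<not> IP_set A}"

definition Cantor_topology :: "(nat \<Rightarrow> bool) topology" where
  "Cantor_topology = product_topology (\<lambda>_. discrete_topology UNIV) UNIV"

(* The topology on the power set of nat transported from the Cantor space along the
   bijection sending a set to its characteristic function. *)
definition powerset_topology :: "nat set topology" where
  "powerset_topology = pullback_topology UNIV (\<lambda>A n. n \<in> A) Cantor_topology"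

definition Polish_space :: "'a topology \<Rightarrow> bool" where
  "Polish_space X \<longleftrightarrow> completely_metrizable_space X \<and> separable_space X"

definition borel_of :: "'a topology \<Rightarrow> 'a measure" where
  "borel_of X = sigma (topspace X) {U. openin X U}"

(* Analytic = continuous image of a Polish space. HOL cannot quantify over types inside a
   definition, so the source Z is taken to be a Polish space whose underlying set is any
   subset of the type nat => nat, with an arbitrary Polish topology on it. Nothing is lost:
   a Polish space has at most continuum many points, hence is homeomorphic to such a Z. *)
definition analytic_in :: "'a topology \<Rightarrow> 'a set \<Rightarrow> bool" where
  "analytic_in X A \<longleftrightarrow>
     (\<exists>(Z :: (nat \<Rightarrow> nat) topology) g. Polish_space Z \<and> continuous_map Z X g \<and> g ` topspace Z = A)"

definition Borel_reducible :: "'y topology \<Rightarrow> 'y set \<Rightarrow> 'x topology \<Rightarrow> 'x set \<Rightarrow> bool" where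
  "Borel_reducible Y B X A \<longleftrightarrow>
     (\<exists>f \<in> measurable (borel_of Y) (borel_of X). f -` A \<inter> topspace Y = B)"

(* The type argument 'y carries the underlying sets of the Polish spaces Y in the definition
   of completeness. A theorem about Sigma11_complete TYPE('y) with 'y a type variable
   therefore speaks about all Polish spaces. *)
definition Sigma11_complete :: "'y itself \<Rightarrow> 'x topology \<Rightarrow> 'x set \<Rightarrow> bool" where
  "Sigma11_complete _ X A \<longleftrightarrow>
     Polish_space X \<and> analytic_in X A \<and>
     (\<forall>(Y :: 'y topology) B. Polish_space Y \<and> analytic_in Y B \<longrightarrow> Borel_reducible Y B X A)"

definition Pi11_complete :: "'y itself \<Rightarrow> 'x topology \<Rightarrow> 'x set \<Rightarrow> bool" where
  "Pi11_complete T X A \<longleftrightarrow> A \<subseteq> topspace X \<and> Sigma11_complete T X (topspace X - A)"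

end

theory Submission
  imports Defs "HOL-Library.Sublist"
begin

text \<open>
  Hardness: an analytic set \<open>B\<close> is given by a Souslin scheme of closed sets, so \<open>y \<in> B\<close> iff the tree
  of all \<open>s\<close> with \<open>y \<in> C s\<close> has an infinite branch, i.e. iff this tree contains an infinite chain.
  Numbering the finite sequences, map \<open>y\<close> to the set of all \<open>n\<close> whose binary support is a chain of the
  tree. An infinite chain \<open>K\<close> makes this an IP-set, witnessed by the powers \<open>2 ^ k\<close> with \<open>k \<in> K\<close>.
  Conversely, among the sums of an infinite set of positive integers there are nonzero multiples of
  any power of 2, formed from elements not used before; adding these one after the other
  causes no carries, so the supports of the partial sums increase to an infinite chain.
\<close>

section \<open>Topology of sequence spaces and of the power set of the natural numbers\<close>

lemma openin_product_discrete_iff: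
  fixes U :: "(nat \<Rightarrow> 'a) set"
  shows "openin (product_topology (\<lambda>_. discrete_topology UNIV) UNIV) U \<longleftrightarrow>
    (\<forall>x\<in>U. \<exists>N. \<forall>y. (\<forall>i<N. y i = x i) \<longrightarrow> y \<in> U)"
    (is "?open \<longleftrightarrow> ?cyl")
proof
  assume ?open
  show ?cyl
  proof
    fix x assume "x \<in> U"
    with \<open>?open\<close> obtain W where W: "finite {i. W i \<noteq> UNIV}" "x \<in> Pi\<^sub>E UNIV W" "Pi\<^sub>E UNIV W \<subseteq> U"
      by (auto simp: openin_product_topology_alt)
    obtain N where N: "\<And>i. W i \<noteq> UNIV \<Longrightarrow> i < N"
      using W(1) unfolding finite_nat_set_iff_bounded by blast
    have "y \<in> U" if "\<forall>i<N. y i = x i" for y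
    proof -
      have "y i \<in> W i" for i
        using N[of i] W(2) that by (cases "i < N") (auto simp: PiE_iff)
      then show ?thesis using W(3) by auto
    qed
    then show "\<exists>N. \<forall>y. (\<forall>i<N. y i = x i) \<longrightarrow> y \<in> U" by blast
  qed
next
  assume cyl: ?cyl
  show ?open
    unfolding openin_product_topology_alt
  proof (intro conjI ballI)
    fix x assume "x \<in> U"
    then obtain N where N: "\<And>y. (\<forall>i<N. y i = x i) \<Longrightarrow> y \<in> U" using cyl by blast
    have "{i. i < N \<and> {x i} \<noteq> UNIV} \<subseteq> {..<N}" by auto
    then have "finite {i. i < N \<and> {x i} \<noteq> UNIV}" using finite_subset by blast
    then show "\<exists>W. finite {i \<in> UNIV. W i \<noteq> topspace (discrete_topology UNIV)} \<and>
          (\<forall>i\<in>UNIV. openin (discrete_topology UNIV) (W i)) \<and> x \<in> Pi\<^sub>E UNIV W \<and> Pi\<^sub>E UNIV W \<subseteq> U"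
      by (intro exI[of _ "\<lambda>i. if i < N then {x i} else UNIV"])
        (auto simp: PiE_iff intro!: N split: if_splits)
  qed
qed

lemma Polish_space_product_discrete:
  "Polish_space (product_topology (\<lambda>_. discrete_topology UNIV) UNIV :: (nat \<Rightarrow> 'a::countable) topology)"
proof -
  let ?X = "product_topology (\<lambda>_. discrete_topology UNIV) UNIV :: (nat \<Rightarrow> 'a) topology"
  have "completely_metrizable_space ?X"
    by (simp add: completely_metrizable_space_product_topology completely_metrizable_space_discrete_topology)
  moreover have "separable_space ?X"
  proof -
    \<comment> \<open>Finite lists padded by a fixed value, here \<open>undefined\<close>: countably
      many, and they meet every cylinder.\<close>
    define D :: "(nat \<Rightarrow> 'a) set" where "D = range (\<lambda>l i. if i < length l then l ! i else undefined)"
    have "D \<inter> T \<noteq> {}" if T: "openin ?X T" "T \<noteq> {}" for T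
    proof -
      from T(2) obtain x where "x \<in> T" by blast
      with T(1) obtain N where x: "\<And>y. (\<forall>i<N. y i = x i) \<Longrightarrow> y \<in> T"
        unfolding openin_product_discrete_iff by blast
      have "(\<lambda>i. if i < length (map x [0..<N]) then map x [0..<N] ! i else undefined) \<in> D \<inter> T"
        unfolding D_def by (intro IntI rangeI x) auto
      then show ?thesis by blast
    qed
    then have "?X closure_of D = topspace ?X" unfolding dense_intersects_open by blast
    moreover have "countable D" unfolding D_def by blast
    ultimately show ?thesis
      unfolding separable_space_def by (intro exI[of _ D]) auto
  qed
  ultimately show ?thesis by (simp add: Polish_space_def)
qed

lemma topspace_powerset_topology [simp]: "topspace powerset_topology = UNIV"
  by (simp add: powerset_topology_def Cantor_topology_def topspace_pullback_topology)

lemma openin_powerset_topology_iff: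
  "openin powerset_topology U \<longleftrightarrow>
    (\<forall>A\<in>U. \<exists>N. \<forall>A'. A' \<inter> {..<N} = A \<inter> {..<N} \<longrightarrow> A' \<in> U)"
proof -
  have eq: "A' \<inter> {..<N} = A \<inter> {..<N} \<longleftrightarrow> (\<forall>i<N. (i \<in> A') = (i \<in> A))" for A A' :: "nat set" and N
    by auto
  have "openin powerset_topology U \<longleftrightarrow> openin Cantor_topology {p. Collect p \<in> U}"
  proof
    assume "openin powerset_topology U"
    then obtain V where V: "openin Cantor_topology V" "U = (\<lambda>A n. n \<in> A) -` V"
      by (auto simp: powerset_topology_def openin_pullback_topology)
    then have "{p. Collect p \<in> U} = V" by auto
    with V show "openin Cantor_topology {p. Collect p \<in> U}" by simp
  next
    assume "openin Cantor_topology {p. Collect p \<in> U}"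
    then show "openin powerset_topology U"
      unfolding powerset_topology_def openin_pullback_topology
      by (intro exI[of _ "{p. Collect p \<in> U}"]) auto
  qed
  also have "\<dots> \<longleftrightarrow> (\<forall>A\<in>U. \<exists>N. \<forall>A'. A' \<inter> {..<N} = A \<inter> {..<N} \<longrightarrow> A' \<in> U)"
    unfolding Cantor_topology_def openin_product_discrete_iff eq
  proof (intro iffI ballI; elim ballE)
    fix A assume "A \<in> U" "\<exists>N. \<forall>y. (\<forall>i<N. y i = (i \<in> A)) \<longrightarrow> y \<in> {p. Collect p \<in> U}"
    then obtain N where N: "\<And>y. (\<forall>i<N. y i = (i \<in> A)) \<Longrightarrow> Collect y \<in> U" by auto
    show "\<exists>N. \<forall>A'. (\<forall>i<N. (i \<in> A') = (i \<in> A)) \<longrightarrow> A' \<in> U"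
      using N[of "\<lambda>i. i \<in> _"] by auto
  next
    fix p assume "p \<in> {p. Collect p \<in> U}"
      "\<exists>N. \<forall>A'. (\<forall>i<N. (i \<in> A') = (i \<in> Collect p)) \<longrightarrow> A' \<in> U"
    then obtain N where N: "\<And>A'. (\<forall>i<N. (i \<in> A') = (i \<in> Collect p)) \<Longrightarrow> A' \<in> U" by blast
    show "\<exists>N. \<forall>y. (\<forall>i<N. y i = p i) \<longrightarrow> y \<in> {p. Collect p \<in> U}"
      using N[of "Collect _"] by auto
  qed auto
  finally show ?thesis .
qed

lemma Polish_space_powerset_topology: "Polish_space powerset_topology"
proof -
  have "homeomorphic_map powerset_topology Cantor_topology (\<lambda>A n. n \<in> A)"
  proof (rule bijective_open_imp_homeomorphic_map)
    show "continuous_map powerset_topology Cantor_topology (\<lambda>A n. n \<in> A)"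
      by (auto simp: continuous_map_def powerset_topology_def openin_pullback_topology
          topspace_pullback_topology Cantor_topology_def)
    show "open_map powerset_topology Cantor_topology (\<lambda>A n. n \<in> A)"
      unfolding open_map_def
    proof (intro allI impI)
      fix U assume "openin powerset_topology U"
      then obtain V where V: "openin Cantor_topology V" "U = (\<lambda>A n. n \<in> A) -` V"
        by (auto simp: powerset_topology_def openin_pullback_topology)
      have "p \<in> (\<lambda>A n. n \<in> A) ` U" if "p \<in> V" for p
        using that V(2) by (intro image_eqI[of _ _ "Collect p"]) auto
      then have "(\<lambda>A n. n \<in> A) ` U = V" using V(2) by auto
      with V(1) show "openin Cantor_topology ((\<lambda>A n. n \<in> A) ` U)" by simp
    qed
    have "p \<in> range (\<lambda>A n. n \<in> A)" for p :: "nat \<Rightarrow> bool"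
      by (intro image_eqI[of _ _ "Collect p"]) auto
    then show "(\<lambda>A n. n \<in> A) ` topspace powerset_topology = topspace Cantor_topology"
      by (auto simp: Cantor_topology_def)
    show "inj_on (\<lambda>A n. n \<in> A) (topspace powerset_topology)"
      by (auto simp: inj_on_def fun_eq_iff)
  qed
  then have hom: "powerset_topology homeomorphic_space Cantor_topology"
    by (rule homeomorphic_map_imp_homeomorphic_space)
  show ?thesis
    using Polish_space_product_discrete[where 'a = bool]
    unfolding Polish_space_def homeomorphic_completely_metrizable_space[OF hom]
      homeomorphic_separable_space[OF hom] Cantor_topology_def .
qed

section \<open>The IP-sets form an analytic set\<close>

lemma subset_FS: "B \<subseteq> FS B"
proof
  fix b assume "b \<in> B"
  then show "b \<in> FS B" unfolding FS_def by (intro CollectI exI[of _ "{b}"]) auto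
qed

lemma FS_mono: "B \<subseteq> C \<Longrightarrow> FS B \<subseteq> FS C"
  unfolding FS_def by blast

text \<open>Deleting 0 keeps \<open>B\<close> infinite and only shrinks \<open>FS B\<close>, and
  \<open>B\<close> lies in \<open>FS B\<close> through one-element sums. Positivity makes the coding
  by gaps possible and later makes all nonempty sums positive.\<close>

lemma IP_set_iff_pos: "IP_set A \<longleftrightarrow> (\<exists>B. infinite B \<and> 0 \<notin> B \<and> FS B \<subseteq> A)"
proof
  assume "IP_set A"
  then obtain B where "infinite B" "FS B \<subseteq> A" by (auto simp: IP_set_def)
  then show "\<exists>B. infinite B \<and> 0 \<notin> B \<and> FS B \<subseteq> A"
    using FS_mono[of "B - {0}" B] by (intro exI[of _ "B - {0}"]) auto
next
  assume "\<exists>B. infinite B \<and> 0 \<notin> B \<and> FS B \<subseteq> A"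
  then show "IP_set A" using subset_FS unfolding IP_set_def by blast
qed

text \<open>Partial sums of positive gaps. Every \<open>x\<close> is allowed, so the infinite sets
  of positive integers are parametrised by the whole Baire space, and the value at \<open>i\<close>
  depends only on finitely many coordinates.\<close>

definition gap_seq :: "(nat \<Rightarrow> nat) \<Rightarrow> nat \<Rightarrow> nat" where
  "gap_seq x i = (\<Sum>j\<le>i. Suc (x j))"

lemma less_gap_seq: "i < gap_seq x i"
  by (induction i) (auto simp: gap_seq_def)

lemma gap_seq_cong: "(\<And>j. j \<le> i \<Longrightarrow> x j = y j) \<Longrightarrow> gap_seq x i = gap_seq y i"
  by (simp add: gap_seq_def)

lemma infinite_range_gap_seq: "infinite (range (gap_seq x))"
  unfolding infinite_nat_iff_unbounded using less_gap_seq by blast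

lemma obtain_gap_seq:
  assumes "infinite B" "0 \<notin> B"
  obtains x where "range (gap_seq x) = B"
proof
  \<comment> \<open>The distance to the preceding element, less one because \<open>gap_seq\<close>
    adds \<open>Suc\<close>. For \<open>i = 0\<close> the preceding element is taken to be 0; as 0
    is not in \<open>B\<close>, the truncated subtraction loses nothing.\<close>
  define x where "x i = enumerate B i - (if i = 0 then 0 else enumerate B (i - 1)) - 1" for i
  have "gap_seq x i = enumerate B i" for i
  proof (induction i)
    case 0
    have "enumerate B 0 \<noteq> 0" using assms by (metis enumerate_in_set)
    then show ?case by (simp add: gap_seq_def x_def)
  next
    case (Suc i)
    have "enumerate B i < enumerate B (Suc i)" using assms by (simp add: enumerate_step)
    then show ?case using Suc by (simp add: gap_seq_def x_def)
  qed
  then have "gap_seq x = enumerate B" by blast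
  then show "range (gap_seq x) = B" using range_enumerate[OF assms(1)] by simp
qed

text \<open>The even coordinates of a point of the Baire space code a set \<open>B\<close>, the odd ones
  an arbitrary set of further elements, so that exactly the IP-sets are parametrised.\<close>

definition IP_param :: "(nat \<Rightarrow> nat) \<Rightarrow> nat set" where
  "IP_param x = FS (range (gap_seq (\<lambda>i. x (2 * i)))) \<union> {n. x (2 * n + 1) = 1}"

lemma range_IP_param: "range IP_param = Collect IP_set"
proof (intro equalityI subsetI)
  fix A assume "A \<in> range IP_param"
  then obtain x where "A = IP_param x" by blast
  then have "FS (range (gap_seq (\<lambda>i. x (2 * i)))) \<subseteq> A" by (simp add: IP_param_def)
  then have "range (gap_seq (\<lambda>i. x (2 * i))) \<subseteq> A" using subset_FS by (rule order_trans[rotated])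
  with \<open>FS _ \<subseteq> A\<close> show "A \<in> Collect IP_set"
    unfolding IP_set_def using infinite_range_gap_seq by (intro CollectI exI conjI)
next
  fix A assume "A \<in> Collect IP_set"
  then obtain B where B: "infinite B" "0 \<notin> B" "FS B \<subseteq> A" by (auto simp: IP_set_iff_pos)
  then obtain z where z: "range (gap_seq z) = B" using obtain_gap_seq by blast
  \<comment> \<open>The odd coordinates may code all of \<open>A\<close>, since \<open>FS B\<close>
    is already contained in it.\<close>
  define x where "x n = (if even n then z (n div 2) else of_bool (n div 2 \<in> A))" for n
  have "IP_param x = A" using B(3) z by (auto simp: IP_param_def x_def)
  then show "A \<in> range IP_param" by blast
qed

text \<open>A sum equal to \<open>n\<close> has summands at most \<open>n\<close>, and these have
  index below \<open>n\<close> by \<open>less_gap_seq\<close>; so only coordinates up to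
  \<open>2 * n + 1\<close> matter. This is the continuity of \<open>IP_param\<close>.\<close>

lemma IP_param_cong_mem:
  assumes "\<And>i. i < 2 * n + 2 \<Longrightarrow> x i = y i" "n \<in> IP_param x"
  shows "n \<in> IP_param y"
proof (cases "x (2 * n + 1) = 1")
  case True
  then show ?thesis using assms(1)[of "2 * n + 1"] by (auto simp: IP_param_def simp del: One_nat_def)
next
  case False
  let ?b = "\<lambda>x. gap_seq (\<lambda>i. x (2 * i))"
  obtain F where F: "F \<subseteq> range (?b x)" "F \<noteq> {}" "finite F" "\<Sum>F = n"
    using assms(2) False by (auto simp: IP_param_def FS_def)
  have "F \<subseteq> range (?b y)"
  proof
    fix a assume "a \<in> F"
    then obtain i where a: "a = ?b x i" using F(1) by blast
    have "a \<le> n" using F \<open>a \<in> F\<close> by (metis member_le_sum zero_le)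
    then have "i < n" using less_gap_seq[of i] a by (metis less_le_trans)
    then have "?b x i = ?b y i" by (intro gap_seq_cong assms(1)) auto
    then show "a \<in> range (?b y)" using a by simp
  qed
  then show ?thesis using F by (auto simp: IP_param_def FS_def)
qed

lemma analytic_in_IP_sets: "analytic_in powerset_topology (Collect IP_set)"
proof -
  let ?Z = "product_topology (\<lambda>_. discrete_topology UNIV) UNIV :: (nat \<Rightarrow> nat) topology"
  have "continuous_map ?Z powerset_topology IP_param"
    unfolding continuous_map_def
  proof (intro conjI allI impI)
    fix U assume U: "openin powerset_topology U"
    show "openin ?Z {x \<in> topspace ?Z. IP_param x \<in> U}"
      unfolding openin_product_discrete_iff
    proof
      fix x assume "x \<in> {x \<in> topspace ?Z. IP_param x \<in> U}"
      then have "IP_param x \<in> U" by simp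
      with U obtain N where N: "\<And>A. A \<inter> {..<N} = IP_param x \<inter> {..<N} \<Longrightarrow> A \<in> U"
        unfolding openin_powerset_topology_iff by blast
      have "IP_param y \<in> U" if y: "\<forall>i<2 * N + 2. y i = x i" for y
      proof -
        have "n \<in> IP_param y \<longleftrightarrow> n \<in> IP_param x" if "n < N" for n
          using that y IP_param_cong_mem[of n x y] IP_param_cong_mem[of n y x] by auto
        then show ?thesis by (intro N) auto
      qed
      then show "\<exists>N. \<forall>y. (\<forall>i<N. y i = x i) \<longrightarrow> y \<in> {x \<in> topspace ?Z. IP_param x \<in> U}"
        by (intro exI[of _ "2 * N + 2"]) auto
    qed
  qed auto
  then show ?thesis
    unfolding analytic_in_def using Polish_space_product_discrete range_IP_param
    by (intro exI[of _ ?Z] exI[of _ IP_param]) auto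
qed

section \<open>Infinite cliques and IP-sets\<close>

text \<open>Infinitely many elements of \<open>B\<close> share one residue modulo \<open>m\<close>;
  any \<open>m\<close> of them add up to 0 modulo \<open>m\<close>.\<close>

lemma exists_sum_dvd:
  fixes B :: "nat set"
  assumes "infinite B" "m > 0"
  obtains F where "finite F" "F \<noteq> {}" "F \<subseteq> B" "m dvd \<Sum>F"
proof -
  have "finite ((\<lambda>b. b mod m) ` B)"
    by (rule finite_subset[of _ "{..<m}"]) (use assms(2) in auto)
  then obtain b where "infinite {a \<in> B. a mod m = b mod m}"
    using pigeonhole_infinite[OF assms(1)] by blast
  then obtain F where F: "finite F" "card F = m" "F \<subseteq> {a \<in> B. a mod m = b mod m}"
    using infinite_arbitrarily_large by blast
  have "\<Sum>F mod m = (\<Sum>a\<in>F. a mod m) mod m" by (simp add: mod_sum_eq)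
  also have "(\<Sum>a\<in>F. a mod m) = (\<Sum>a\<in>F. b mod m)" using F(3) by (intro sum.cong) auto
  also have "\<dots> mod m = 0" using F(2) by simp
  finally have "m dvd \<Sum>F" by (simp add: mod_eq_0_iff_dvd)
  moreover have "F \<noteq> {}" using F(2) assms(2) by auto
  moreover have "F \<subseteq> B" using F(3) by blast
  ultimately show ?thesis using that F(1) by blast
qed

text \<open>\<open>set_decode\<close> is the binary support. The digits of \<open>a\<close> lie
  below position \<open>k\<close>, those of \<open>c\<close> at or above it, so nothing is carried
  and the digits of \<open>a\<close> survive. Strictness is injectivity of
  \<open>set_decode\<close>.\<close>

lemma set_decode_add_multiple:
  assumes "a < 2 ^ k" "2 ^ k dvd c" "c > 0"
  shows "set_decode a \<subset> set_decode (a + c)"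
proof -
  have "j \<in> set_decode (a + c)" if "j \<in> set_decode a" for j
  proof -
    have odd: "odd (a div 2 ^ j)" using that by (simp add: set_decode_def)
    have "j < k"
    proof (rule ccontr)
      assume "\<not> j < k"
      then have "(2::nat) ^ k \<le> 2 ^ j" by simp
      with assms(1) have "a < 2 ^ j" by linarith
      then show False using odd by simp
    qed
    \<comment> \<open>As \<open>j < k\<close>, even \<open>2 ^ Suc j\<close> divides
      \<open>c\<close>, so adding \<open>c\<close> keeps the parity of the quotient by
      \<open>2 ^ j\<close>.\<close>
    then obtain q where c: "c = 2 ^ j * (2 * q)"
      using assms(2) by (metis dvd_def dvd_trans le_imp_power_dvd Suc_leI power_Suc2 mult.assoc)
    have "(a + c) div 2 ^ j = a div 2 ^ j + 2 * q" unfolding c by simp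
    then show ?thesis using odd by (simp add: set_decode_def)
  qed
  moreover have "set_decode a \<noteq> set_decode (a + c)"
    using assms(3) by (metis add_cancel_right_right less_irrefl set_decode_inverse)
  ultimately show ?thesis by blast
qed

text \<open>The pairs include \<open>i = j\<close>, so \<open>R i i\<close> can express a condition
  on the single vertex \<open>i\<close>; below it says that \<open>i\<close> codes a node of the
  tree.\<close>

definition clique_numbers :: "(nat \<Rightarrow> nat \<Rightarrow> bool) \<Rightarrow> nat set" where
  "clique_numbers R = {n. \<forall>i\<in>set_decode n. \<forall>j\<in>set_decode n. R i j}"

lemma IP_set_clique_numbers_iff:
  "IP_set (clique_numbers R) \<longleftrightarrow> (\<exists>K. infinite K \<and> (\<forall>i\<in>K. \<forall>j\<in>K. R i j))"
proof
  assume "IP_set (clique_numbers R)"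
  then obtain B where B: "infinite B" "0 \<notin> B" "FS B \<subseteq> clique_numbers R"
    by (auto simp: IP_set_iff_pos)
  have "\<exists>f. \<forall>n. (finite (f n) \<and> f n \<noteq> {} \<and> f n \<subseteq> B) \<and>
      set_decode (\<Sum>(f n)) \<subset> set_decode (\<Sum>(f (Suc n)))"
  \<comment> \<open>The recursion runs over finite subsets of \<open>B\<close>, not over their sums,
    so that each new block can avoid the elements already used.\<close>
  proof (rule dependent_nat_choice)
    obtain b where "b \<in> B" using B(1) by fastforce
    then show "\<exists>F. finite F \<and> F \<noteq> {} \<and> F \<subseteq> B" by (intro exI[of _ "{b}"]) auto
  next
    fix F :: "nat set" assume F: "finite F \<and> F \<noteq> {} \<and> F \<subseteq> B"
    \<comment> \<open>The exponent only has to put the power above the sum of \<open>F\<close>; that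
      sum itself will do, because \<open>n < 2 ^ n\<close>.\<close>
    obtain G where G: "finite G" "G \<noteq> {}" "G \<subseteq> B - F" "2 ^ \<Sum>F dvd \<Sum>G"
      using exists_sum_dvd[of "B - F" "2 ^ \<Sum>F"] B(1) F by auto
    have "\<Sum>G > 0" using G B(2) by (metis DiffD1 gr0I subsetD sum_eq_0_iff all_not_in_conv)
    moreover have "\<Sum>(F \<union> G) = \<Sum>F + \<Sum>G" using F G by (intro sum.union_disjoint) auto
    ultimately have "set_decode (\<Sum>F) \<subset> set_decode (\<Sum>(F \<union> G))"
      using set_decode_add_multiple[OF less_exp G(4)] by simp
    then show "\<exists>G. (finite G \<and> G \<noteq> {} \<and> G \<subseteq> B) \<and> set_decode (\<Sum>F) \<subset> set_decode (\<Sum>G)"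
      using F G by (intro exI[of _ "F \<union> G"]) auto
  qed
  then obtain f where "\<forall>n. (finite (f n) \<and> f n \<noteq> {} \<and> f n \<subseteq> B) \<and>
      set_decode (\<Sum>(f n)) \<subset> set_decode (\<Sum>(f (Suc n)))" ..
  then have f: "finite (f n)" "f n \<noteq> {}" "f n \<subseteq> B"
      "set_decode (\<Sum>(f n)) \<subset> set_decode (\<Sum>(f (Suc n)))" for n
    by simp_all
  define D where "D n = set_decode (\<Sum>(f n))" for n
  have D: "strict_mono D" using f(4) by (simp add: D_def strict_mono_Suc_iff)
  have clique: "R i j" if "i \<in> D n" "j \<in> D n" for i j n
  proof -
    have "\<Sum>(f n) \<in> clique_numbers R" using f B(3) unfolding FS_def by blast
    then show ?thesis using that by (simp add: clique_numbers_def D_def)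
  qed
  \<comment> \<open>A finite union would have only finitely many subsets, but the \<open>D n\<close>
    are pairwise distinct.\<close>
  have "infinite (\<Union>n. D n)"
  proof
    assume fin: "finite (\<Union>n. D n)"
    have "inj D" using D by (rule strict_mono_imp_inj_on)
    moreover have "range D \<subseteq> Pow (\<Union>n. D n)" by blast
    ultimately show False using fin
      by (meson finite_Pow_iff finite_imageD finite_subset infinite_UNIV_nat)
  qed
  moreover have "R i j" if "i \<in> (\<Union>n. D n)" "j \<in> (\<Union>n. D n)" for i j
  proof -
    from that obtain m n where "i \<in> D m" "j \<in> D n" by blast
    then have "i \<in> D (max m n)" "j \<in> D (max m n)"
      using strict_mono_mono[OF D] by (meson max.cobounded1 max.cobounded2 monoD subsetD)+
    then show ?thesis by (rule clique)
  qed
  ultimately show "\<exists>K. infinite K \<and> (\<forall>i\<in>K. \<forall>j\<in>K. R i j)" by blast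
next
  assume "\<exists>K. infinite K \<and> (\<forall>i\<in>K. \<forall>j\<in>K. R i j)"
  then obtain K where K: "infinite K" "\<And>i j. i \<in> K \<Longrightarrow> j \<in> K \<Longrightarrow> R i j" by blast
  have inj: "inj ((^) (2::nat))" by (simp add: inj_on_def)
  have "n \<in> clique_numbers R" if n: "n \<in> FS ((^) 2 ` K)" for n
  proof -
    from n obtain F where "F \<subseteq> (^) 2 ` K" "finite F" "n = \<Sum>F" by (auto simp: FS_def)
    then obtain E where E: "E \<subseteq> K" "finite E" "n = \<Sum>((^) 2 ` E)"
      using finite_subset_image by metis
    \<comment> \<open>A sum of distinct powers of 2 has the set of exponents as its binary
      support.\<close>
    have "n = set_encode E"
      using E(3) inj by (simp add: set_encode_def sum.reindex inj_on_subset)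
    then show ?thesis using E K(2) by (auto simp: clique_numbers_def)
  qed
  moreover have "infinite ((^) (2::nat) ` K)"
    using K(1) inj by (meson finite_imageD inj_on_subset subset_UNIV)
  ultimately show "IP_set (clique_numbers R)"
    unfolding IP_set_iff_pos by (intro exI[of _ "(^) 2 ` K"]) auto
qed

section \<open>Closed Souslin schemes for analytic sets\<close>

text \<open>A sequence \<open>x\<close> prescribes ever better approximations from a countable dense
  set to a point of the source. Completeness produces that point, and the Hausdorff property
  identifies its image with \<open>y\<close>.\<close>

lemma analytic_in_closed_scheme:
  fixes Y :: "'y topology"
  assumes "Hausdorff_space Y" "analytic_in Y B"
  obtains C :: "nat list \<Rightarrow> 'y set" where
    "\<And>s. closedin Y (C s)" "\<And>s t. prefix s t \<Longrightarrow> C t \<subseteq> C s"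
    "\<And>y. y \<in> B \<longleftrightarrow> (\<exists>x. \<forall>n. y \<in> C (map x [0..<n]))"
proof -
  obtain Z :: "(nat \<Rightarrow> nat) topology" and g where Z: "Polish_space Z"
    and g: "continuous_map Z Y g" "g ` topspace Z = B"
    using assms(2) by (auto simp: analytic_in_def)
  obtain M d where M: "Metric_space M d" "Metric_space.mcomplete M d"
      "Z = Metric_space.mtopology M d"
    using Z by (auto simp: Polish_space_def completely_metrizable_space_def)
  interpret Metric_space M d by (rule M(1))
  have cont: "continuous_map mtopology Y g" and B: "B = g ` M" using g M(3) by auto
  obtain Q where Q: "countable Q" "mtopology closure_of Q = M"
    using Z M(3) by (auto simp: Polish_space_def separable_space_def)
  define q where "q = from_nat_into Q"
  have q: "\<exists>k. d (q k) z < r \<and> q k \<in> M" if "z \<in> M" "r > 0" for z r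
  proof -
    have "Q \<inter> mball z r \<noteq> {}"
      using Q(2) that dense_intersects_open[of mtopology Q] centre_in_mball_iff[of z r]
      by (metis openin_mball topspace_mtopology empty_iff)
    then obtain p where p: "p \<in> Q" "p \<in> mball z r" by blast
    have "range q = Q" unfolding q_def using p Q(1) by (intro range_from_nat_into) auto
    then obtain k where "p = q k" using p by blast
    then show ?thesis using p commute by auto
  qed
  \<comment> \<open>Membership of \<open>q (s ! i)\<close> in \<open>M\<close> is demanded
    explicitly, because the metric axioms hold only on \<open>M\<close> and nothing recorded about
    \<open>Q\<close> places all its points there.\<close>
  define W where "W s = {z \<in> M. \<forall>i<length s. q (s ! i) \<in> M \<and> d (q (s ! i)) z < inverse (Suc i)}" for s
  \<comment> \<open>The images themselves need not be closed; completeness of \<open>d\<close> makes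
    up for the points added by the closures.\<close>
  define C where "C s = Y closure_of (g ` W s)" for s
  show thesis
  proof
    show "closedin Y (C s)" for s by (simp add: C_def)
    show "C t \<subseteq> C s" if "prefix s t" for s t
    proof -
      from that obtain u where t: "t = s @ u" by (auto simp: prefix_def)
      have "z \<in> W s" if "z \<in> W t" for z
        unfolding W_def
      proof (intro CollectI conjI allI impI)
        show "z \<in> M" using that by (simp add: W_def)
        fix i assume "i < length s"
        then have "i < length t" "t ! i = s ! i" by (simp_all add: t nth_append)
        then show "q (s ! i) \<in> M" "d (q (s ! i)) z < inverse (Suc i)"
          using that unfolding W_def by fastforce+
      qed
      then have "W t \<subseteq> W s" by blast
      then show ?thesis unfolding C_def by (intro closure_of_mono image_mono)
    qed
    show "y \<in> B \<longleftrightarrow> (\<exists>x. \<forall>n. y \<in> C (map x [0..<n]))" for y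
    proof
      assume "y \<in> B"
      then obtain z where z: "z \<in> M" "y = g z" using B by blast
      have "\<exists>k. q k \<in> M \<and> d (q k) z < inverse (Suc i)" for i
        using q[OF z(1), of "inverse (Suc i)"] by auto
      then obtain x where x: "\<And>i. q (x i) \<in> M \<and> d (q (x i)) z < inverse (Suc i)" by metis
      have "y \<in> C (map x [0..<n])" for n
      proof -
        have "z \<in> W (map x [0..<n])" using x z by (simp add: W_def)
        moreover have "g ` W (map x [0..<n]) \<subseteq> topspace Y"
          using cont by (auto simp: W_def continuous_map_def)
        ultimately show ?thesis using z(2) closure_of_subset unfolding C_def by blast
      qed
      then show "\<exists>x. \<forall>n. y \<in> C (map x [0..<n])" by blast
    next
      assume "\<exists>x. \<forall>n. y \<in> C (map x [0..<n])"
      then obtain x where x: "\<And>n. y \<in> C (map x [0..<n])" by blast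
      have W: "z \<in> M" "i < n \<Longrightarrow> q (x i) \<in> M" "i < n \<Longrightarrow> d (q (x i)) z < inverse (Suc i)"
        if "z \<in> W (map x [0..<n])" for i n z
        using that by (auto simp: W_def)
      \<comment> \<open>The closure of the empty set is empty. Any choice of points
        \<open>w n\<close> is then Cauchy, since later points share the centres
        \<open>q (x i)\<close>.\<close>
      have "W (map x [0..<n]) \<noteq> {}" for n using x[of n] by (auto simp: C_def)
      then have "\<forall>n. \<exists>z. z \<in> W (map x [0..<n])" by blast
      from choice[OF this] obtain w where w: "\<And>n. w n \<in> W (map x [0..<n])" by blast
      have close: "d a b < 2 * inverse (Suc i)"
        if "a \<in> W (map x [0..<m])" "b \<in> W (map x [0..<n])" "i < m" "i < n" for a b i m n
      proof -
        have "d a b \<le> d a (q (x i)) + d (q (x i)) b" using that W by (intro triangle) auto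
        also have "\<dots> < 2 * inverse (Suc i)"
          using W(3)[OF that(1,3)] W(3)[OF that(2,4)] commute[of a "q (x i)"] by linarith
        finally show ?thesis .
      qed
      have small: "\<exists>i. 2 * inverse (real (Suc i)) < r" if "r > 0" for r
        using reals_Archimedean[of "r / 2"] that by (auto simp: mult.commute)
      have "MCauchy w"
        unfolding MCauchy_def
      proof (intro conjI allI impI)
        show "range w \<subseteq> M" using w W(1) by blast
        fix r :: real assume "r > 0"
        then obtain i where i: "2 * inverse (real (Suc i)) < r" using small by blast
        have "d (w n) (w n') < r" if "Suc i \<le> n" "Suc i \<le> n'" for n n'
          using close[OF w w, of i n n'] that i by simp
        then show "\<exists>N. \<forall>n n'. N \<le> n \<longrightarrow> N \<le> n' \<longrightarrow> d (w n) (w n') < r" by blast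
      qed
      then obtain z where "limitin mtopology w z sequentially"
        using M(2) mcomplete_def by blast
      then have z: "z \<in> M" "\<And>r. r > 0 \<Longrightarrow> \<exists>N. \<forall>n\<ge>N. d (w n) z < r"
        unfolding limit_metric_sequentially by blast+
      \<comment> \<open>Otherwise disjoint open sets separate them. For large \<open>i\<close> all
        of \<open>W (map x [0..<Suc i])\<close> is so near \<open>z\<close> that its image lies in
        \<open>U\<close>, yet \<open>y\<close> is in the closure of this image.\<close>
      have "y = g z"
      proof (rule ccontr)
        assume "y \<noteq> g z"
        moreover have "y \<in> topspace Y" using x[of 0] by (simp add: C_def in_closure_of)
        moreover have "g z \<in> topspace Y" using cont z(1) by (auto simp: continuous_map_def)
        ultimately obtain U V where UV: "openin Y U" "openin Y V" "g z \<in> U" "y \<in> V" "disjnt U V"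
          using assms(1) unfolding Hausdorff_space_def by metis
        have "openin mtopology {a \<in> M. g a \<in> U}"
          using openin_continuous_map_preimage[OF cont UV(1)] by simp
        then obtain r where r: "r > 0" "mball z r \<subseteq> {a \<in> M. g a \<in> U}"
          using z(1) UV(3) by (auto simp: openin_mtopology)
        obtain i where i: "2 * inverse (real (Suc i)) < r / 2" using small[of "r / 2"] r(1) by auto
        obtain N where N: "\<And>n. n \<ge> N \<Longrightarrow> d (w n) z < r / 2" using z(2)[of "r / 2"] r(1) by auto
        have "g a \<in> U" if a: "a \<in> W (map x [0..<Suc i])" for a
        proof -
          \<comment> \<open>Late enough that \<open>w ?m\<close> is within \<open>r / 2\<close> of
            \<open>z\<close> and also shares the centre of index \<open>i\<close> with
            \<open>a\<close>.\<close>
          let ?m = "max N (Suc i)"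
          have "d a z \<le> d a (w ?m) + d (w ?m) z" using a w W(1) z(1) by (intro triangle) blast+
          also have "\<dots> < r" using N[of ?m] close[OF a w, of i ?m] i by (simp add: less_max_iff_disj)
          finally have "a \<in> mball z r" using W(1)[OF a] z(1) commute[of a z] by simp
          then show ?thesis using r(2) by blast
        qed
        moreover obtain v where "v \<in> g ` W (map x [0..<Suc i])" "v \<in> V"
          using x[of "Suc i"] UV(2,4) unfolding C_def in_closure_of by blast
        ultimately show False using UV(5) by (auto simp: disjnt_iff)
      qed
      then show "y \<in> B" using B z(1) by blast
    qed
  qed
qed

section \<open>Infinite chains and branches of trees\<close>

text \<open>Comparable lists of equal length coincide, so an infinite chain has unbounded lengths
  and its members glue to a branch, along which \<open>P\<close> holds by closure under prefixes.
  Conversely, the initial segments of a branch form a chain.\<close>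

lemma infinite_prefix_chain_iff_branch:
  assumes mono: "\<And>s t. prefix s t \<Longrightarrow> P t \<Longrightarrow> P s"
  shows "(\<exists>K. infinite K \<and> (\<forall>i\<in>K. \<forall>j\<in>K. P (list_decode i) \<and>
      (prefix (list_decode i) (list_decode j) \<or> prefix (list_decode j) (list_decode i)))) \<longleftrightarrow>
    (\<exists>x. \<forall>n. P (map x [0..<n]))" (is "?chain \<longleftrightarrow> ?branch")
proof
  assume ?chain
  then obtain K where K: "infinite K" "\<And>i. i \<in> K \<Longrightarrow> P (list_decode i)"
      "\<And>i j. i \<in> K \<Longrightarrow> j \<in> K \<Longrightarrow>
        prefix (list_decode i) (list_decode j) \<or> prefix (list_decode j) (list_decode i)"
    by blast
  define S where "S = list_decode ` K"
  have S: "infinite S" "\<And>s. s \<in> S \<Longrightarrow> P s"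
      "\<And>s t. s \<in> S \<Longrightarrow> t \<in> S \<Longrightarrow> prefix s t \<or> prefix t s"
    using K finite_imageD[OF _ inj_list_decode] by (auto simp: S_def)
  have "inj_on length S"
  proof (rule inj_onI)
    fix s t assume "s \<in> S" "t \<in> S" "length s = length t"
    then show "s = t" using S(3)[of s t] by (auto simp: prefix_def)
  qed
  then have "infinite (length ` S)" using S(1) finite_imageD by blast
  then have "\<exists>s\<in>S. n < length s" for n by (auto simp: infinite_nat_iff_unbounded)
  then obtain t where t: "\<And>n. t n \<in> S" "\<And>n. n < length (t n)" by metis
  have nth: "s ! i = u ! i" if "s \<in> S" "u \<in> S" "i < length s" "i < length u" for s u i
    using S(3)[OF that(1,2)] that(3,4) by (auto simp: prefix_def nth_append)
  \<comment> \<open>Entry \<open>i\<close> is read off \<open>t i\<close>, which is longer than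
    \<open>i\<close>; by comparability \<open>t n\<close> has the same entry when
    \<open>i < n\<close>.\<close>
  have "P (map (\<lambda>i. t i ! i) [0..<n])" for n
  proof -
    have "map (\<lambda>i. t i ! i) [0..<n] = take n (t n)"
      using t less_trans[OF _ t(2)] by (intro nth_equalityI) (auto intro!: nth)
    then have "prefix (map (\<lambda>i. t i ! i) [0..<n]) (t n)" by (simp add: take_is_prefix)
    then show ?thesis using mono S(2) t(1) by blast
  qed
  then show ?branch by blast
next
  assume ?branch
  then obtain x where x: "\<And>n. P (map x [0..<n])" by blast
  define K where "K = range (\<lambda>n. list_encode (map x [0..<n]))"
  have "inj (\<lambda>n. list_encode (map x [0..<n]))"
    by (rule injI) (metis diff_zero length_map length_upt list_encode_eq)
  then have "infinite K" unfolding K_def by (rule range_inj_infinite)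
  moreover have "prefix (map x [0..<m]) (map x [0..<n]) \<or> prefix (map x [0..<n]) (map x [0..<m])" for m n
  proof -
    have "prefix (map x [0..<m]) (map x [0..<n])" if "m \<le> n" for m n
      using that by (metis le_add_diff_inverse map_append prefixI upt_add_eq_append zero_le)
    then show ?thesis using linear[of m n] by blast
  qed
  ultimately show ?chain using x by (intro exI[of _ K]) (auto simp: K_def)
qed

section \<open>Borel measurability and the reduction\<close>

lemma space_borel_of [simp]: "space (borel_of X) = topspace X"
  by (simp add: borel_of_def space_measure_of_conv)

lemma sets_borel_of: "sets (borel_of X) = sigma_sets (topspace X) {U. openin X U}"
  unfolding borel_of_def by (rule sets_measure_of) (auto dest: openin_subset)

lemma closedin_in_borel_of: 
  assumes "closedin X C"
  shows "C \<in> sets (borel_of X)"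
proof -
  have "topspace X - C \<in> sets (borel_of X)"
    using assms unfolding sets_borel_of by (intro sigma_sets.Basic) auto
  then have "space (borel_of X) - (topspace X - C) \<in> sets (borel_of X)" by (rule sets.compl_sets)
  then show ?thesis
    using closedin_subset[OF assms] by (simp add: double_diff)
qed

text \<open>An open set is a countable union of cylinders, and the preimage of a cylinder is
  described by the conditions \<open>n \<in> f y\<close>.\<close>

lemma measurable_into_powersetI:
  assumes "\<And>n. {y \<in> space M. n \<in> f y} \<in> sets M"
  shows "f \<in> measurable M (borel_of powerset_topology)"
  unfolding borel_of_def
proof (rule measurable_measure_of)
  fix U assume "U \<in> {U. openin powerset_topology U}"
  then have U: "\<forall>A\<in>U. \<exists>N. \<forall>A'. A' \<inter> {..<N} = A \<inter> {..<N} \<longrightarrow> A' \<in> U"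
    by (simp add: openin_powerset_topology_iff)
  \<comment> \<open>A pair codes the cylinder of sets with trace \<open>set_decode k\<close> below
    \<open>N\<close>. If \<open>k\<close> codes elements beyond \<open>N\<close>, the cylinder is
    empty and the pair is in \<open>I\<close> vacuously.\<close>
  define I :: "(nat \<times> nat) set" where "I = {(N, k). \<forall>A. A \<inter> {..<N} = set_decode k \<longrightarrow> A \<in> U}"
  have "f y \<in> U \<longleftrightarrow> (\<exists>(N, k)\<in>I. \<forall>n. (n \<in> f y \<and> n < N) \<longleftrightarrow> n \<in> set_decode k)" for y
  proof
    assume "f y \<in> U"
    then obtain N where N: "\<And>A. A \<inter> {..<N} = f y \<inter> {..<N} \<Longrightarrow> A \<in> U" using U by blast
    have *: "set_decode (set_encode (f y \<inter> {..<N})) = f y \<inter> {..<N}" by simp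
    then have "(N, set_encode (f y \<inter> {..<N})) \<in> I" using N by (simp add: I_def)
    then show "\<exists>(N, k)\<in>I. \<forall>n. (n \<in> f y \<and> n < N) \<longleftrightarrow> n \<in> set_decode k"
      using * by (intro bexI[of _ "(N, set_encode (f y \<inter> {..<N}))"]) auto
  next
    assume "\<exists>(N, k)\<in>I. \<forall>n. (n \<in> f y \<and> n < N) \<longleftrightarrow> n \<in> set_decode k"
    then obtain N k where "(N, k) \<in> I" "f y \<inter> {..<N} = set_decode k" by auto
    then show "f y \<in> U" by (simp add: I_def)
  qed
  then have "f -` U \<inter> space M = {y \<in> space M. \<exists>p\<in>I. \<forall>n. (n \<in> f y \<and> n < fst p) \<longleftrightarrow> n \<in> set_decode (snd p)}"
    by (auto simp: case_prod_beta)
  also have "\<dots> \<in> sets M"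
  proof -
    have [measurable]: "Measurable.pred M (\<lambda>y. n \<in> f y)" for n
      using assms by (simp add: pred_def)
    show ?thesis by measurable
  qed
  finally show "f -` U \<inter> space M \<in> sets M" .
qed auto

lemma Borel_reducible_IP_sets:
  fixes Y :: "'y topology"
  assumes "Hausdorff_space Y" "analytic_in Y B"
  shows "Borel_reducible Y B powerset_topology (Collect IP_set)"
proof -
  obtain C :: "nat list \<Rightarrow> 'y set" where C: "\<And>s. closedin Y (C s)"
      "\<And>s t. prefix s t \<Longrightarrow> C t \<subseteq> C s"
      "\<And>y. y \<in> B \<longleftrightarrow> (\<exists>x. \<forall>n. y \<in> C (map x [0..<n]))"
    using analytic_in_closed_scheme[OF assms] by blast
  \<comment> \<open>Testing \<open>C\<close> at \<open>i\<close> alone suffices, since a clique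
    satisfies \<open>R\<close> for both orders of each pair.\<close>
  define R where "R y i j \<longleftrightarrow> y \<in> C (list_decode i) \<and>
      (prefix (list_decode i) (list_decode j) \<or> prefix (list_decode j) (list_decode i))" for y i j
  have "IP_set (clique_numbers (R y)) \<longleftrightarrow> y \<in> B" for y
    unfolding IP_set_clique_numbers_iff R_def C(3)
    by (rule infinite_prefix_chain_iff_branch) (use C(2) in blast)
  moreover have "B \<subseteq> topspace Y"
    using C(3) closedin_subset[OF C(1)] by blast
  ultimately have "(\<lambda>y. clique_numbers (R y)) -` Collect IP_set \<inter> topspace Y = B" by auto
  moreover have "(\<lambda>y. clique_numbers (R y)) \<in> measurable (borel_of Y) (borel_of powerset_topology)"
  proof (rule measurable_into_powersetI)
    fix n
    \<comment> \<open>For fixed \<open>n\<close>, the point \<open>y\<close> enters only through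
      membership in the closed sets \<open>C s\<close>; the prefix conditions are constant.\<close>
    have [measurable]: "C s \<in> sets (borel_of Y)" for s by (rule closedin_in_borel_of[OF C(1)])
    show "{y \<in> space (borel_of Y). n \<in> clique_numbers (R y)} \<in> sets (borel_of Y)"
      unfolding clique_numbers_def R_def mem_Collect_eq by measurable
  qed
  ultimately show ?thesis unfolding Borel_reducible_def by blast
qed

theorem theorem2p2:
  shows "Pi11_complete TYPE('y) powerset_topology Hindman_ideal"
proof -
  have "topspace powerset_topology - Hindman_ideal = Collect IP_set"
    by (auto simp: Hindman_ideal_def)
  moreover have "Hausdorff_space Y" if "Polish_space Y" for Y :: "'y topology"
    using that by (simp add: Polish_space_def completely_metrizable_imp_metrizable_space
        metrizable_imp_Hausdorff_space)
  ultimately show ?thesis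
    unfolding Pi11_complete_def Sigma11_complete_def
    using Polish_space_powerset_topology analytic_in_IP_sets Borel_reducible_IP_sets by auto
qed

end
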